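(* There exists a subset $A\subset\mathbb{N}$ of asymptotic density one such that for all $k\in A$, $$\psi(k)=O\left(\frac{k}{(\log\log k)^{\delta}(\log\log\log k)^{3/2}}\right),$$ where $\delta=1-\frac{1+\log\log 2}{\log 2}$.
   Context: For a set $X$, $X^{(2)}$ denotes the set of unordered pairs of elements of $X$, and $[k]=\{1,\dots,k\}$. Given a surjective colouring $\Delta:\mathbb{N}^{(2)}\to[k]$, a set $X\subset\mathbb{N}$ is called (exactly) $m$-coloured if $\Delta(X^{(2)})$ has exactly $m$ elements. Define $\mathcal{F}_{\Delta}=\{m\in[k] : \text{there is an infinite } m\text{-coloured } X\subset\mathbb{N}\}$ and $\psi(k)=\min|\mathcal{F}_{\Delta}|$, the minimum over all surjective colourings $\Delta:\mathbb{N}^{(2)}\to[k]$. The implied constant in $O(\cdot)$ is absolute. *)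

theory Defs
  imports Complex_Main "HOL-Library.Ramsey"
begin

text \<open>
  The set of unordered pairs of elements of X is \<^term>\<open>nsets X 2\<close>, so a colouring is a function on
  sets of naturals of which only the values on two-element sets matter.
\<close>

definition surj_colouring :: "nat \<Rightarrow> (nat set \<Rightarrow> nat) \<Rightarrow> bool" where
  "surj_colouring k \<Delta> \<longleftrightarrow> \<Delta> ` nsets UNIV 2 = {1..k}"

definition exactly_coloured :: "(nat set \<Rightarrow> nat) \<Rightarrow> nat \<Rightarrow> nat set \<Rightarrow> bool" where
  "exactly_coloured \<Delta> m X \<longleftrightarrow> card (\<Delta> ` nsets X 2) = m"

definition color_counts :: "nat \<Rightarrow> (nat set \<Rightarrow> nat) \<Rightarrow> nat set" where
  "color_counts k \<Delta> = {m \<in> {1..k}. \<exists>X. infinite X \<and> exactly_coloured \<Delta> m X}"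

text \<open>
  An infimum of a nonempty set of naturals is its minimum; the set below is nonempty exactly when
  \<^term>\<open>k \<ge> 1\<close>, and the value at 0 is meaningless (see \<open>psi_attained\<close> and \<open>psi_le\<close>).
\<close>

definition psi :: "nat \<Rightarrow> nat" where
  "psi k = Inf {card (color_counts k \<Delta>) | \<Delta>. surj_colouring k \<Delta>}"

definition has_density :: "nat set \<Rightarrow> real \<Rightarrow> bool" where
  "has_density A d \<longleftrightarrow> (\<lambda>n. real (card (A \<inter> {1..n})) / real n) \<longlonglongrightarrow> d"

definition ford_delta :: real where
  "ford_delta = 1 - (1 + ln (ln 2)) / ln 2"

lemma surj_colouring_exists:
  assumes "k \<ge> 1"
  shows "\<exists>\<Delta>. surj_colouring k \<Delta>"
proof -
  define D where "D = (\<lambda>e. max 1 (min k (Max e)) :: nat)"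
  have "D ` nsets UNIV 2 = {1..k}"
  proof (intro equalityI subsetI)
    fix x assume "x \<in> D ` nsets UNIV 2"
    then show "x \<in> {1..k}" using assms by (auto simp: D_def)
  next
    fix x assume x: "x \<in> {1..k}"
    then have "{0, x} \<in> nsets UNIV 2" by (auto simp: nsets_def)
    moreover have "x = D {0, x}" using x by (auto simp: D_def)
    ultimately show "x \<in> D ` nsets UNIV 2" by blast
  qed
  then show ?thesis unfolding surj_colouring_def by blast
qed

lemma psi_attained:
  assumes "k \<ge> 1"
  shows "\<exists>\<Delta>. surj_colouring k \<Delta> \<and> psi k = card (color_counts k \<Delta>)"
proof -
  have "psi k \<in> {card (color_counts k \<Delta>) | \<Delta>. surj_colouring k \<Delta>}"
    unfolding psi_def using surj_colouring_exists[OF assms] by (intro Inf_nat_def1) blast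
  then show ?thesis by blast
qed

lemma psi_le:
  assumes "surj_colouring k \<Delta>"
  shows "psi k \<le> card (color_counts k \<Delta>)"
  unfolding psi_def using assms by (intro cInf_lower) auto

end

theory Submission
  imports Defs "HOL-Computational_Algebra.Squarefree" "HOL-Analysis.Harmonic_Numbers"
    "HOL-Real_Asymp.Real_Asymp"
begin

text \<open>
  If \<open>k - 1 = a * b\<close>, colour the edges of a complete bipartite graph with parts of sizes \<open>a\<close> and \<open>b\<close>
  distinctly and everything else with one further colour: an infinite set then sees \<open>1 + x * y\<close> colours
  with \<open>x \<le> a\<close> and \<open>y \<le> b\<close>, so \<open>psi k\<close> is at most one more than the size of the \<open>a\<close> by \<open>b\<close>
  multiplication table. Ford's sharp estimate for that table is not needed. Turan's
  variance inequality saves a factor \<open>ln (ln (min a b))\<close>, and almost every \<open>k - 1\<close> has a prime factor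
  \<open>p\<close> for which \<open>ln (ln p)\<close> is at least a constant multiple of \<open>ln (ln k)\<close>, while the cofactor
  is large too. Hence \<open>psi k = O(k / ln (ln k))\<close> on a set of density one, and this suffices because
  \<open>ford_delta < 1\<close>.
\<close>

section \<open>Turan's variance inequality\<close>

definition recip_sum :: "nat set \<Rightarrow> real" where
  "recip_sum P = (\<Sum>p\<in>P. 1 / real p)"

definition num_div :: "nat set \<Rightarrow> nat \<Rightarrow> nat" where
  "num_div P n = card {p\<in>P. p dvd n}"

lemma recip_sum_nonneg: "recip_sum P \<ge> 0"
  unfolding recip_sum_def by (intro sum_nonneg) auto

lemma recip_sum_le_card:
  assumes "\<And>p. p \<in> P \<Longrightarrow> prime p"
  shows "recip_sum P \<le> real (card P)"
proof -
  have "recip_sum P \<le> (\<Sum>p\<in>P. 1)"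
    unfolding recip_sum_def using assms by (intro sum_mono) (auto dest!: assms prime_ge_1_nat simp: divide_le_eq)
  then show ?thesis by simp
qed

text \<open>Telescoping via 1/(n+1)^2 <= 1/n - 1/(n+1); the term \<open>1 / real n\<close> carries
  the induction and is 0 at \<open>n = 0\<close>, where division by zero gives 0.\<close>

lemma sum_inverse_squares_le: "(\<Sum>d=1..n. 1 / real d ^ 2) \<le> 2 - 1 / real n"
proof (induction n)
  case (Suc n)
  have "1 / real (Suc n) ^ 2 \<le> 1 / real n - 1 / real (Suc n)" if "n > 0"
  proof -
    have "1 / real (Suc n) ^ 2 \<le> 1 / (real n * real (Suc n))"
      using that by (intro frac_le) (auto simp: power2_eq_square)
    also have "\<dots> = 1 / real n - 1 / real (Suc n)"
      using that by (simp add: field_simps)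
    finally show ?thesis .
  qed
  with Suc.IH show ?case by (cases "n = 0") simp_all
qed simp

lemma of_bool_sum_num_div:
  assumes "finite P"
  shows "real (num_div P n) = (\<Sum>p\<in>P. of_bool (p dvd n))"
  using assms by (simp add: num_div_def sum.If_cases of_bool_def Int_def)

lemma sum_dvd_le:
  assumes "m > 0"
  shows "(\<Sum>n=1..N. of_bool (m dvd n)) \<le> real N / real m"
    and "(\<Sum>n=1..N. of_bool (m dvd n)) \<ge> real N / real m - 1"
proof -
  have eq: "{n\<in>{1..N}. m dvd n} = (\<lambda>i. m * i) ` {1..N div m}"
    using assms by (auto simp: dvd_def less_eq_div_iff_mult_less_eq mult.commute)
  have "(\<Sum>n=1..N. of_bool (m dvd n)) = real (card {n\<in>{1..N}. m dvd n})"
    by (simp add: sum.If_cases of_bool_def Int_def)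
  also have "\<dots> = real (N div m)"
    unfolding eq using assms by (subst card_image) (auto simp: inj_on_def)
  finally have *: "(\<Sum>n=1..N. of_bool (m dvd n)) = real (N div m)" .
  show "(\<Sum>n=1..N. of_bool (m dvd n)) \<le> real N / real m"
    unfolding * by (rule of_nat_div_le_of_nat)
  show "(\<Sum>n=1..N. of_bool (m dvd n)) \<ge> real N / real m - 1"
    unfolding * using floor_divide_of_nat_eq[of N m, where 'a=real] by linarith
qed

text \<open>When the square is expanded, the terms N L^2 cancel. There remain N L from the diagonal
  of the second moment and 2 L times the rounding error of the first moment, which is at most
  \<open>card P\<close> and so at most N.\<close>

lemma turan_variance:
  assumes P: "finite P" "\<And>p. p \<in> P \<Longrightarrow> prime p" and card: "card P \<le> N"
  shows "(\<Sum>n=1..N. (real (num_div P n) - recip_sum P)^2) \<le> 3 * real N * recip_sum P"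
proof -
  define L where "L = recip_sum P"
  have L0: "L \<ge> 0" unfolding L_def by (rule recip_sum_nonneg)
  have pos: "p > 0" if "p \<in> P" for p using P(2)[OF that] by (rule prime_gt_0_nat)
  have "(\<Sum>n=1..N. real (num_div P n)) = (\<Sum>p\<in>P. \<Sum>n=1..N. of_bool (p dvd n))"
    by (simp only: of_bool_sum_num_div[OF P(1)]) (rule sum.swap)
  also have "\<dots> \<ge> (\<Sum>p\<in>P. real N / real p - 1)"
    using pos by (intro sum_mono sum_dvd_le)
  also have "(\<Sum>p\<in>P. real N / real p - 1) = real N * L - real (card P)"
    by (simp add: sum_subtractf L_def recip_sum_def sum_distrib_left)
  finally have mean: "(\<Sum>n=1..N. real (num_div P n)) \<ge> real N * L - real N"
    using card by simp
  \<comment> \<open>Distinct primes p and q both divide n exactly when p q does, so only the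
    diagonal needs an extra term.\<close>
  have pair: "(\<Sum>n=1..N. of_bool (p dvd n) * of_bool (q dvd n))
      \<le> real N / real p * (1 / real q) + (if p = q then real N / real p else 0)"
    if "p \<in> P" "q \<in> P" for p q
  proof (cases "p = q")
    case True
    have "(\<Sum>n=1..N. of_bool (p dvd n) * of_bool (q dvd n)) = (\<Sum>n=1..N. of_bool (p dvd n) :: real)"
      using True by (intro sum.cong) auto
    also have "\<dots> \<le> real N / real p" using pos that by (intro sum_dvd_le)
    finally show ?thesis using True by (simp add: add_increasing)
  next
    case False
    then have "coprime p q" using that P(2) by (simp add: primes_coprime)
    then have "p dvd n \<and> q dvd n \<longleftrightarrow> p * q dvd n" for n
      by (auto intro: divides_mult dest: dvd_mult_left dvd_mult_right)
    then have "(\<Sum>n=1..N. of_bool (p dvd n) * of_bool (q dvd n)) = (\<Sum>n=1..N. of_bool (p * q dvd n) :: real)"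
      by (intro sum.cong refl) (simp flip: of_bool_conj)
    also have "\<dots> \<le> real N / real (p * q)" using pos that by (intro sum_dvd_le) simp
    finally show ?thesis using False by simp
  qed
  have "(\<Sum>n=1..N. real (num_div P n)^2)
      = (\<Sum>n=1..N. \<Sum>p\<in>P. \<Sum>q\<in>P. of_bool (p dvd n) * of_bool (q dvd n))"
    by (simp only: of_bool_sum_num_div[OF P(1)] power2_eq_square sum_product)
  also have "\<dots> = (\<Sum>p\<in>P. \<Sum>n=1..N. \<Sum>q\<in>P. of_bool (p dvd n) * of_bool (q dvd n))"
    by (rule sum.swap)
  also have "\<dots> = (\<Sum>p\<in>P. \<Sum>q\<in>P. \<Sum>n=1..N. of_bool (p dvd n) * of_bool (q dvd n))"
    by (intro sum.cong refl sum.swap)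
  also have "\<dots> \<le> (\<Sum>p\<in>P. \<Sum>q\<in>P. real N / real p * (1 / real q) + (if p = q then real N / real p else 0))"
    by (intro sum_mono pair)
  also have "\<dots> = (\<Sum>p\<in>P. real N / real p * L + real N / real p)"
    using P(1) by (intro sum.cong refl)
      (simp add: sum.distrib L_def recip_sum_def sum_distrib_left sum.delta)
  also have "\<dots> = (\<Sum>p\<in>P. real N / real p) * L + (\<Sum>p\<in>P. real N / real p)"
    by (simp only: sum.distrib sum_distrib_right)
  also have "(\<Sum>p\<in>P. real N / real p) = real N * L"
    by (simp add: L_def recip_sum_def sum_distrib_left)
  finally have sq: "(\<Sum>n=1..N. real (num_div P n)^2) \<le> real N * L * L + real N * L" .
  have "(\<Sum>n=1..N. (real (num_div P n) - L)^2)
      = (\<Sum>n=1..N. real (num_div P n)^2) - 2 * L * (\<Sum>n=1..N. real (num_div P n)) + real N * L^2"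
    by (simp add: power2_diff sum.distrib sum_subtractf sum_distrib_left mult_ac)
  \<comment> \<open>The first moment enters with a negative sign, so its lower bound
    \<open>mean\<close> is the one that applies.\<close>
  also have "\<dots> \<le> (real N * L * L + real N * L) - 2 * L * (real N * L - real N) + real N * L^2"
    using sq mean L0 by (intro add_mono diff_mono mult_left_mono) auto
  also have "\<dots> = 3 * real N * L" by (simp add: algebra_simps power2_eq_square)
  finally show ?thesis unfolding L_def .
qed

text \<open>Chebyshev's inequality for the variance just bounded.\<close>

lemma turan_card:
  assumes P: "finite P" "\<And>p. p \<in> P \<Longrightarrow> prime p" and card: "card P \<le> N"
    and L: "recip_sum P > 0" and c: "c > 0"
  shows "real (card {n\<in>{1..N}. \<bar>real (num_div P n) - recip_sum P\<bar> \<ge> c * recip_sum P})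
           \<le> 3 / c^2 * real N / recip_sum P"
proof -
  define L where "L = recip_sum P"
  define B where "B = {n\<in>{1..N}. \<bar>real (num_div P n) - L\<bar> \<ge> c * L}"
  have L0: "L > 0" using L by (simp add: L_def)
  have "real (card B) * (c * L)^2 = (\<Sum>n\<in>B. (c * L)^2)" by simp
  also have "\<dots> \<le> (\<Sum>n\<in>B. (real (num_div P n) - L)^2)"
  proof (rule sum_mono)
    fix n assume "n \<in> B"
    then have "c * L \<le> \<bar>real (num_div P n) - L\<bar>" by (simp add: B_def)
    then show "(c * L)^2 \<le> (real (num_div P n) - L)^2"
      using L0 c by (metis abs_le_square_iff abs_of_nonneg less_imp_le mult_nonneg_nonneg)
  qed
  also have "\<dots> \<le> (\<Sum>n=1..N. (real (num_div P n) - L)^2)"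
    by (intro sum_mono2) (auto simp: B_def)
  also have "\<dots> \<le> 3 * real N * L" unfolding L_def by (rule turan_variance[OF P card])
  finally have "real (card B) * (c * L)^2 \<le> 3 * real N * L" .
  then have "real (card B) \<le> 3 / c^2 * real N / L"
    using L0 c by (simp add: field_simps power2_eq_square)
  then show ?thesis by (simp add: B_def L_def)
qed

section \<open>Sums of reciprocals of primes\<close>

definition primes_upto :: "nat \<Rightarrow> nat set" where
  "primes_upto n = {p. prime p \<and> p \<le> n}"

lemma finite_primes_upto [simp]: "finite (primes_upto n)"
  by (rule finite_subset[of _ "{..n}"]) (auto simp: primes_upto_def)

lemma card_primes_upto_le: "card (primes_upto n) \<le> n"
proof -
  have "card (primes_upto n) \<le> card {1..n}"
    by (rule card_mono) (auto simp: primes_upto_def dest: prime_ge_1_nat)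
  then show ?thesis by simp
qed

text \<open>Every m is a squarefree number times a square, so the harmonic sum is at most the
  product of 1 + 1/p over primes p <= n times the sum of 1/d^2, which is at most 2. Then 1 + u <=
  exp u.\<close>

lemma harm_le_exp_recip_sum: "harm n \<le> 2 * exp (recip_sum (primes_upto n))"
proof -
  define P where "P = primes_upto n"
  define g where "g = (\<lambda>m::nat. (prime_factors (squarefree_part m), square_part m))"
  have dec: "m = \<Prod>(fst (g m)) * snd (g m) ^ 2" for m :: nat
  proof -
    have "squarefree_part m = (\<Prod>p\<in>prime_factors (squarefree_part m). p ^ multiplicity p (squarefree_part m))"
      by (subst prod_prime_factors) auto
    also have "\<dots> = \<Prod>(prime_factors (squarefree_part m))"
      using squarefree_factorial_semiring'[of "squarefree_part m"] by (intro prod.cong) auto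
    finally have "\<Prod>(prime_factors (squarefree_part m)) = squarefree_part m" ..
    then show ?thesis using squarefree_decompose[of m] by (simp add: g_def)
  qed
  have inj: "inj_on g {1..n}"
    by (rule inj_onI) (metis dec)
  have im: "g ` {1..n} \<subseteq> Pow P \<times> {1..n}"
  proof (clarsimp simp: g_def, intro conjI subsetI)
    fix m p assume m: "Suc 0 \<le> m" "m \<le> n"
    have le: "d \<le> n" if "d dvd m" for d using that m dvd_imp_le[of d m] by auto
    show "square_part m \<le> n"
      by (rule le) (metis dvd_mult_right power2_eq_square square_part_square_dvd)
    show "Suc 0 \<le> square_part m" using m by (metis Suc_leI gr0I not_one_le_zero One_nat_def square_part_0_iff)
    assume p: "p \<in> prime_factors (squarefree_part m)"
    then have "p dvd squarefree_part m" by auto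
    then have "p dvd m" by (metis dvd_mult2 squarefree_decompose)
    then show "p \<in> P" using p le by (auto simp: P_def primes_upto_def)
  qed
  have "harm n = (\<Sum>m=1..n. 1 / real m)" by (simp add: harm_def inverse_eq_divide)
  also have "\<dots> = (\<Sum>m=1..n. case g m of (T, d) \<Rightarrow> (\<Prod>p\<in>T. 1 / real p) * (1 / real d ^ 2))"
  proof (rule sum.cong)
    fix m
    have "real m = (\<Prod>p\<in>fst (g m). real p) * real (snd (g m)) ^ 2"
      by (subst dec) simp
    then show "1 / real m = (case g m of (T, d) \<Rightarrow> (\<Prod>p\<in>T. 1 / real p) * (1 / real d ^ 2))"
      by (simp add: split_beta prod_dividef)
  qed simp
  also have "\<dots> = (\<Sum>(T, d)\<in>g ` {1..n}. (\<Prod>p\<in>T. 1 / real p) * (1 / real d ^ 2))"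
    by (subst sum.reindex[OF inj]) (simp only: comp_def)
  also have "\<dots> \<le> (\<Sum>(T, d)\<in>Pow P \<times> {1..n}. (\<Prod>p\<in>T. 1 / real p) * (1 / real d ^ 2))"
    using im by (intro sum_mono2) (auto simp: P_def intro!: prod_nonneg divide_nonneg_nonneg)
  also have "\<dots> = (\<Sum>T\<in>Pow P. \<Prod>p\<in>T. 1 / real p) * (\<Sum>d=1..n. 1 / real d ^ 2)"
    by (simp only: sum_product sum.cartesian_product)
  also have "(\<Sum>T\<in>Pow P. \<Prod>p\<in>T. 1 / real p) = (\<Prod>p\<in>P. 1 / real p + 1)"
    by (subst prod_add) (simp_all add: P_def)
  also have "\<dots> * (\<Sum>d=1..n. 1 / real d ^ 2) \<le> (\<Prod>p\<in>P. 1 / real p + 1) * 2"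
    using sum_inverse_squares_le[of n]
    by (intro mult_left_mono prod_nonneg) (auto intro: order_trans)
  also have "(\<Prod>p\<in>P. 1 / real p + 1) \<le> (\<Prod>p\<in>P. exp (1 / real p))"
    by (intro prod_mono) (auto simp: exp_ge_add_one_self add.commute)
  also have "\<dots> = exp (recip_sum P)" by (simp add: recip_sum_def exp_sum P_def)
  finally show ?thesis by (simp add: P_def mult.commute)
qed

text \<open>Logarithms are taken in ln (n + 1) <= \<open>harm n\<close> and the preceding bound at n
  = 2^(2^t), where ln (ln n) = t ln 2 + ln (ln 2).\<close>

lemma recip_sum_primes_ge:
  "recip_sum (primes_upto (2 ^ 2 ^ t)) \<ge> real t * ln 2 + ln (ln 2) - ln 2"
proof -
  have "2 ^ t * ln 2 = ln (real (2 ^ 2 ^ t))" by (simp add: ln_realpow)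
  also have "\<dots> \<le> ln (real (2 ^ 2 ^ t) + 1)" by (subst ln_le_cancel_iff) (simp_all add: add_pos_pos)
  also have "\<dots> \<le> harm (2 ^ 2 ^ t)" by (rule ln_le_harm)
  also have "\<dots> \<le> 2 * exp (recip_sum (primes_upto (2 ^ 2 ^ t)))" by (rule harm_le_exp_recip_sum)
  finally have "ln (2 ^ t * ln 2) \<le> ln (2 * exp (recip_sum (primes_upto (2 ^ 2 ^ t))))"
    by (subst ln_le_cancel_iff) auto
  then show ?thesis by (simp add: ln_mult ln_realpow)
qed

section \<open>Chebyshev-type upper bounds for primes\<close>

lemma prod_primes_dvd:
  fixes n :: nat
  assumes "finite Q" "\<And>p. p \<in> Q \<Longrightarrow> prime p" "\<And>p. p \<in> Q \<Longrightarrow> p dvd n"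
  shows "\<Prod>Q dvd n"
  using assms
proof (induction Q)
  case (insert p Q)
  have "coprime p (\<Prod>Q)"
    using insert by (intro prod_coprime_right primes_coprime) auto
  then show ?case using insert by (auto intro: divides_mult)
qed simp

text \<open>The primes in \<open>(n, 2n]\<close> all divide the binomial coefficient \<open>2n choose n\<close>.\<close>

lemma power_card_primes_le:
  "n ^ card {p. prime p \<and> n < p \<and> p \<le> 2 * n} \<le> 4 ^ n"
proof -
  define Q where "Q = {p. prime p \<and> n < p \<and> p \<le> 2 * n}"
  have fin: "finite Q" by (rule finite_subset[of _ "{..2*n}"]) (auto simp: Q_def)
  have "p dvd (2 * n choose n)" if "p \<in> Q" for p
  proof -
    have p: "prime p" "n < p" "p \<le> 2 * n" using that by (auto simp: Q_def)
    have "fact n * fact (2 * n - n) * (2 * n choose n) = (fact (2 * n) :: nat)"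
      by (rule binomial_fact_lemma) simp
    moreover have "p dvd fact (2 * n)" using p by (simp add: prime_dvd_fact_iff)
    moreover have "\<not> p dvd fact n" using p by (simp add: prime_dvd_fact_iff)
    ultimately show ?thesis using p(1) by (metis add_diff_cancel_left' mult_2 prime_dvd_mult_iff)
  qed
  then have "\<Prod>Q dvd (2 * n choose n)"
    using fin by (intro prod_primes_dvd) (auto simp: Q_def)
  then have "\<Prod>Q \<le> (2 * n choose n)" by (intro dvd_imp_le) auto
  also have "\<dots> \<le> (\<Sum>k\<le>2*n. 2 * n choose k)" by (rule member_le_sum) auto
  also have "\<dots> = 4 ^ n" by (simp add: choose_row_sum power_mult)
  finally have "\<Prod>Q \<le> 4 ^ n" .
  moreover have "n ^ card Q \<le> \<Prod>Q"
    using prod_mono[of Q "\<lambda>_. n" "\<lambda>p. p"] by (auto simp: Q_def)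
  ultimately show ?thesis by (simp add: Q_def)
qed

text \<open>By \<open>power_card_primes_le\<close> at n = 2^j the block has at most 2 * 2^j / j
  primes, each with reciprocal at most 1/2^j.\<close>

lemma recip_sum_dyadic_le:
  assumes "j > 0"
  shows "recip_sum {p. prime p \<and> 2 ^ j < p \<and> p \<le> 2 ^ Suc j} \<le> 2 / real j"
proof -
  define Q where "Q = {p::nat. prime p \<and> 2 ^ j < p \<and> p \<le> 2 ^ Suc j}"
  have "(2::nat) ^ (j * card Q) \<le> 2 ^ (2 * 2 ^ j)"
    using power_card_primes_le[of "2 ^ j"] by (simp add: Q_def power_mult)
  then have "j * card Q \<le> 2 * 2 ^ j" by simp
  then have "real j * real (card Q) \<le> 2 * 2 ^ j"
    by (metis (mono_tags, lifting) of_nat_le_iff of_nat_mult of_nat_numeral of_nat_power)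
  then have "real (card Q) / 2 ^ j \<le> 2 / real j" using assms by (simp add: field_simps)
  moreover have "recip_sum Q \<le> (\<Sum>p\<in>Q. 1 / 2 ^ j)"
    unfolding recip_sum_def
  proof (rule sum_mono)
    fix p assume "p \<in> Q"
    then have "real (2 ^ j) \<le> real p" by (simp only: of_nat_le_iff) (simp add: Q_def)
    then have "2 ^ j \<le> real p" by simp
    then show "1 / real p \<le> 1 / 2 ^ j" by (intro frac_le) auto
  qed
  ultimately show ?thesis by (simp add: Q_def)
qed

text \<open>Dyadic blocks are added one at a time; the constant 1 covers the prime 2.\<close>

lemma recip_sum_primes_le_sum:
  "recip_sum (primes_upto (2 ^ Suc J)) \<le> 1 + 2 * (\<Sum>j=1..J. 1 / real j)"
proof (induction J)
  case 0
  have "primes_upto 2 = {2}"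
    by (auto simp: primes_upto_def dest: prime_ge_2_nat)
  then show ?case by (simp add: recip_sum_def)
next
  case (Suc J)
  have *: "primes_upto (2 ^ Suc (Suc J))
     = primes_upto (2 ^ Suc J) \<union> {p. prime p \<and> 2 ^ Suc J < p \<and> p \<le> 2 ^ Suc (Suc J)}"
    by (auto simp: primes_upto_def)
  have "recip_sum (primes_upto (2 ^ Suc (Suc J)))
     = recip_sum (primes_upto (2 ^ Suc J)) + recip_sum {p. prime p \<and> 2 ^ Suc J < p \<and> p \<le> 2 ^ Suc (Suc J)}"
    unfolding * recip_sum_def
    by (rule sum.union_disjoint) (auto simp: primes_upto_def)
  then show ?case using Suc.IH recip_sum_dyadic_le[of "Suc J"] by simp
qed

text \<open>Each block from 2^s to 2^(s+1) - 1 has 2^s terms of size at most 1/2^s, so it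
  contributes at most 1.\<close>

lemma sum_inverse_pow2_le: "(\<Sum>j=1..<2 ^ s. 1 / real j) \<le> real s"
proof (induction s)
  case (Suc s)
  have "(\<Sum>j=1..<2 ^ Suc s. 1 / real j) = (\<Sum>j=1..<2 ^ s. 1 / real j) + (\<Sum>j=2 ^ s..<2 ^ Suc s. 1 / real j)"
    by (rule sum.atLeastLessThan_concat[symmetric]) auto
  moreover have "(\<Sum>j=2 ^ s..<2 ^ Suc s. 1 / real j) \<le> (\<Sum>j=(2::nat) ^ s..<2 ^ Suc s. 1 / 2 ^ s)"
  proof (rule sum_mono)
    fix j :: nat assume "j \<in> {2 ^ s..<2 ^ Suc s}"
    then have "real (2 ^ s) \<le> real j" by (simp only: of_nat_le_iff) simp
    then have "2 ^ s \<le> real j" by simp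
    then show "1 / real j \<le> 1 / 2 ^ s" by (intro frac_le) auto
  qed
  ultimately show ?case using Suc.IH by simp
qed simp

lemma recip_sum_primes_le: "recip_sum (primes_upto (2 ^ 2 ^ s)) \<le> 1 + 2 * real s"
proof -
  have "Suc (2 ^ s - 1) = (2::nat) ^ s" by simp
  moreover have "{1..2 ^ s - 1} = {1..<(2::nat) ^ s}" by auto
  ultimately show ?thesis
    using recip_sum_primes_le_sum[of "2 ^ s - 1"] sum_inverse_pow2_le[of s] by simp
qed

section \<open>Multiplication tables\<close>

lemma sum_inverse_squares_finite_le:
  assumes "finite P" "0 \<notin> P"
  shows "(\<Sum>p\<in>P. 1 / real p ^ 2) \<le> 2"
proof -
  have "P \<subseteq> {1..Max (insert 0 P)}"
  proof
    fix p assume "p \<in> P"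
    then show "p \<in> {1..Max (insert 0 P)}" using assms by (cases "p = 0") auto
  qed
  then have "(\<Sum>p\<in>P. 1 / real p ^ 2) \<le> (\<Sum>p=1..Max (insert 0 P). 1 / real p ^ 2)"
    by (intro sum_mono2) auto
  also have "\<dots> \<le> 2" using sum_inverse_squares_le[of "Max (insert 0 P)"] by (rule order_trans) simp
  finally show ?thesis .
qed

text \<open>Inclusion-exclusion, as a prime divides a product exactly when it divides a
  factor.\<close>

lemma num_div_mult:
  assumes "finite P" "\<And>p. p \<in> P \<Longrightarrow> prime p"
  shows "num_div P (x * y) + card {p\<in>P. p dvd x \<and> p dvd y} = num_div P x + num_div P y"
proof -
  have "{p\<in>P. p dvd x * y} = {p\<in>P. p dvd x} \<union> {p\<in>P. p dvd y}"
    using assms(2) by (auto simp: prime_dvd_mult_iff)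
  moreover have "{p\<in>P. p dvd x \<and> p dvd y} = {p\<in>P. p dvd x} \<inter> {p\<in>P. p dvd y}" by auto
  ultimately show ?thesis
    unfolding num_div_def using card_Un_Int[of "{p\<in>P. p dvd x}" "{p\<in>P. p dvd y}"] assms(1) by simp
qed

text \<open>A prime p divides both coordinates of at most a fraction 1/p^2 of the pairs, so the
  average number of common primes is at most 2. Markov's inequality finishes.\<close>

lemma card_common_divisors_le:
  assumes P: "finite P" "\<And>p. p \<in> P \<Longrightarrow> prime p" and c: "c > 0"
  shows "real (card {(x, y) \<in> {1..a} \<times> {1..b}. real (card {p\<in>P. p dvd x \<and> p dvd y}) \<ge> c})
           \<le> 2 / c * (real a * real b)"
proof -
  define D where "D = {(x, y) \<in> {1..a} \<times> {1..b}. real (card {p\<in>P. p dvd x \<and> p dvd y}) \<ge> c}"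
  have D: "D \<subseteq> {1..a} \<times> {1..b}" by (auto simp: D_def)
  have pos: "p > 0" if "p \<in> P" for p using P(2)[OF that] by (rule prime_gt_0_nat)
  have cnt: "real (card {p\<in>P. p dvd x \<and> p dvd y}) = (\<Sum>p\<in>P. of_bool (p dvd x) * of_bool (p dvd y))" for x y
    using P(1) by (simp add: Int_def flip: of_bool_conj)
  have "real (card D) * c = (\<Sum>z\<in>D. c)" by simp
  also have "\<dots> \<le> (\<Sum>(x, y)\<in>D. real (card {p\<in>P. p dvd x \<and> p dvd y}))"
    by (intro sum_mono) (auto simp: D_def)
  also have "\<dots> \<le> (\<Sum>(x, y)\<in>{1..a} \<times> {1..b}. real (card {p\<in>P. p dvd x \<and> p dvd y}))"
    using D by (intro sum_mono2) auto
  also have "\<dots> = (\<Sum>(x, y)\<in>{1..a} \<times> {1..b}. \<Sum>p\<in>P. of_bool (p dvd x) * of_bool (p dvd y))"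
    by (simp only: cnt)
  also have "\<dots> = (\<Sum>p\<in>P. \<Sum>(x, y)\<in>{1..a} \<times> {1..b}. of_bool (p dvd x) * of_bool (p dvd y))"
    unfolding case_prod_unfold by (rule sum.swap)
  also have "\<dots> = (\<Sum>p\<in>P. (\<Sum>x=1..a. of_bool (p dvd x)) * (\<Sum>y=1..b. of_bool (p dvd y)))"
    by (simp only: sum_product sum.cartesian_product)
  also have "\<dots> \<le> (\<Sum>p\<in>P. real a / real p * (real b / real p))"
    using pos by (intro sum_mono mult_mono sum_dvd_le sum_nonneg) auto
  also have "\<dots> = real a * real b * (\<Sum>p\<in>P. 1 / real p ^ 2)"
    by (simp add: sum_distrib_left power2_eq_square)
  also have "\<dots> \<le> real a * real b * 2"
    using P pos by (intro mult_left_mono sum_inverse_squares_finite_le) auto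
  finally have "real (card D) \<le> real a * real b * 2 / c" using c by (simp add: le_divide_eq)
  then show ?thesis by (simp add: D_def mult_ac)
qed

text \<open>
  Erdos's argument, with \<open>L\<close> the sum of the reciprocals of \<open>P\<close>: for a typical pair \<open>(x, y)\<close> the product
  has about \<open>2L\<close> divisors in \<open>P\<close>, whereas a typical integer below \<open>a * b\<close> has only about \<open>L\<close>.
\<close>

lemma card_mult_table_le:
  assumes P: "finite P" "\<And>p. p \<in> P \<Longrightarrow> prime p" and card: "card P \<le> a" "card P \<le> b"
    and L: "recip_sum P > 0"
  shows "real (card ((\<lambda>(x, y). x * y) ` ({1..a} \<times> {1..b}))) \<le> 404 * (real a * real b) / recip_sum P"
proof -
  define L where "L = recip_sum P"
  define f where "f = (\<lambda>(x, y). x * y :: nat)"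
  define E where "E = (\<lambda>c N. {n\<in>{1..N}. \<bar>real (num_div P n) - recip_sum P\<bar> \<ge> c * recip_sum P})"
  define D where "D = {(x, y) \<in> {1..a} \<times> {1..b}. real (card {p\<in>P. p dvd x \<and> p dvd y}) \<ge> L / 4}"
  have L0: "L > 0" using L by (simp add: L_def)
  have fin: "finite (E c N)" for c N by (simp add: E_def)
  have finD: "finite D" by (rule finite_subset[of _ "{1..a} \<times> {1..b}"]) (auto simp: D_def)
  have "P \<noteq> {}" using L by (auto simp: recip_sum_def)
  then have "card P > 0" using P(1) by (simp add: card_gt_0_iff)
  then have "a * 1 \<le> a * b" using card by (intro mult_le_mono) linarith+
  then have cardab: "card P \<le> a * b" using card(1) by linarith
  \<comment> \<open>Outside the exceptional sets the thresholds conflict: more than 7/8 L + 7/8 L -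
    1/4 L = 3/2 L primes of \<open>P\<close> would divide x y, while avoiding
    \<open>E (1/2) (a * b)\<close> forces fewer than 3/2 L.\<close>
  have sub: "f ` ({1..a} \<times> {1..b}) \<subseteq> E (1/2) (a * b) \<union> f ` (E (1/8) a \<times> {1..b})
      \<union> f ` ({1..a} \<times> E (1/8) b) \<union> f ` D"
  proof
    fix n assume "n \<in> f ` ({1..a} \<times> {1..b})"
    then obtain x y where xy: "x \<in> {1..a}" "y \<in> {1..b}" "n = x * y" by (auto simp: f_def)
    show "n \<in> E (1/2) (a * b) \<union> f ` (E (1/8) a \<times> {1..b}) \<union> f ` ({1..a} \<times> E (1/8) b) \<union> f ` D"
    proof (rule ccontr)
      assume neg: "\<not> ?thesis"
      have n: "n \<in> {1..a*b}" using xy by (auto intro: mult_le_mono)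
      have "x \<notin> E (1/8) a" "y \<notin> E (1/8) b" "(x, y) \<notin> D" "n \<notin> E (1/2) (a * b)"
        using neg xy by (force simp: f_def image_iff)+
      then have "\<bar>real (num_div P x) - L\<bar> < 1/8 * L" "\<bar>real (num_div P y) - L\<bar> < 1/8 * L"
        "real (card {p\<in>P. p dvd x \<and> p dvd y}) < L / 4" "\<bar>real (num_div P n) - L\<bar> < 1/2 * L"
        using xy(1,2) n unfolding E_def D_def L_def by (auto simp: not_le)
      moreover have "real (num_div P n) + real (card {p\<in>P. p dvd x \<and> p dvd y})
          = real (num_div P x) + real (num_div P y)"
        using num_div_mult[OF P, of x y] unfolding xy(3) by linarith
      ultimately show False by linarith
    qed
  qed
  have "card (f ` ({1..a} \<times> {1..b})) \<le> card (E (1/2) (a * b) \<union> f ` (E (1/8) a \<times> {1..b})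
      \<union> f ` ({1..a} \<times> E (1/8) b) \<union> f ` D)"
    using fin finD by (intro card_mono sub) auto
  also have "\<dots> \<le> card (E (1/2) (a * b)) + card (f ` (E (1/8) a \<times> {1..b}))
      + card (f ` ({1..a} \<times> E (1/8) b)) + card (f ` D)"
    by (intro order_trans[OF card_Un_le] add_mono order_refl)
  also have "\<dots> \<le> card (E (1/2) (a * b)) + card (E (1/8) a) * b + a * card (E (1/8) b) + card D"
    using fin finD by (intro add_mono order_refl order_trans[OF card_image_le]) auto
  finally have "real (card (f ` ({1..a} \<times> {1..b})))
     \<le> real (card (E (1/2) (a * b)) + card (E (1/8) a) * b + a * card (E (1/8) b) + card D)"
    by (simp only: of_nat_le_iff)
  also have "\<dots> = real (card (E (1/2) (a * b))) + real (card (E (1/8) a)) * real b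
        + real a * real (card (E (1/8) b)) + real (card D)"
    by simp
  \<comment> \<open>The factor 3/c^2 is 12 for c = 1/2 and 192 for c = 1/8, and 2/(1/4) = 8; the
    total is 12 + 192 + 192 + 8 = 404.\<close>
  also have "\<dots> \<le> 12 * real (a * b) / L + 192 * real a / L * real b + real a * (192 * real b / L)
      + 8 * (real a * real b) / L"
  proof (intro add_mono mult_mono)
    show "real (card (E (1/2) (a * b))) \<le> 12 * real (a * b) / L"
      using turan_card[OF P cardab L, of "1/2"] by (simp add: E_def L_def power2_eq_square)
    show "real (card (E (1/8) a)) \<le> 192 * real a / L" "real (card (E (1/8) b)) \<le> 192 * real b / L"
      using turan_card[OF P card(1) L, of "1/8"] turan_card[OF P card(2) L, of "1/8"]
      by (simp_all add: E_def L_def power2_eq_square)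
    show "real (card D) \<le> 8 * (real a * real b) / L"
      using card_common_divisors_le[OF P, of "L / 4" a b] L0 by (simp add: D_def)
  qed (use L0 in auto)
  also have "\<dots> = 404 * (real a * real b) / L" using L0 by (simp add: field_simps)
  finally show ?thesis by (simp add: L_def f_def)
qed

section \<open>Bipartite colourings\<close>

text \<open>
  The complete bipartite graph between \<open>{..<a}\<close> and \<open>{a..<a+b}\<close> is coloured injectively, and all
  remaining pairs share the colour 1.
\<close>

definition bip_colouring :: "nat \<Rightarrow> nat \<Rightarrow> nat set \<Rightarrow> nat" where
  "bip_colouring a b e =
     (if Min e < a \<and> Max e \<in> {a..<a+b} then Min e * b + (Max e - a) + 2 else 1)"

text \<open>Colour 1 always occurs because an infinite \<open>X\<close> has two elements that are at
  least a + b; this is where infinitude enters.\<close>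

lemma bip_colouring_image:
  assumes "infinite X"
  shows "bip_colouring a b ` nsets X 2
    = insert 1 ((\<lambda>(i, j). i * b + (j - a) + 2) ` ((X \<inter> {..<a}) \<times> (X \<inter> {a..<a+b})))"
    (is "_ = insert 1 (?f ` ?S)")
proof (intro equalityI subsetI)
  fix c assume "c \<in> bip_colouring a b ` nsets X 2"
  then obtain e where e: "e \<in> nsets X 2" "c = bip_colouring a b e" by auto
  then have "finite e" "e \<noteq> {}" "e \<subseteq> X" by (auto simp: nsets_def)
  then have "Min e \<in> X" "Max e \<in> X" by (meson Max_in Min_in subsetD)+
  then show "c \<in> insert 1 (?f ` ?S)"
    unfolding e(2) bip_colouring_def by (auto intro!: image_eqI[of _ _ "(Min e, Max e)"])
next
  fix c assume "c \<in> insert 1 (?f ` ?S)"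
  then consider "c = 1" | i j where "i \<in> X" "i < a" "j \<in> X" "a \<le> j" "j < a + b" "c = i * b + (j - a) + 2"
    by auto
  then show "c \<in> bip_colouring a b ` nsets X 2"
  proof cases
    case 1
    obtain i where i: "i \<in> X" "i \<ge> a + b" using assms by (metis infinite_nat_iff_unbounded_le)
    obtain j where j: "j \<in> X" "j > i" using assms by (metis infinite_nat_iff_unbounded)
    have "bip_colouring a b {i, j} = 1" "{i, j} \<in> nsets X 2"
      using i j by (auto simp: bip_colouring_def nsets_def card_insert_if)
    then show ?thesis using 1 by (metis image_eqI)
  next
    case 2
    have "bip_colouring a b {i, j} = c" "{i, j} \<in> nsets X 2"
      using 2 by (auto simp: bip_colouring_def nsets_def card_insert_if max_def)
    then show ?thesis by (metis image_eqI)
  qed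
qed

text \<open>Without the offset 2 the value is a two-digit expansion in base b with last digit j - a
  < b, so i and j can be read off.\<close>

lemma inj_on_bip: "inj_on (\<lambda>(i, j). i * b + (j - a) + 2) ({..<a} \<times> {a..<a+b::nat})"
proof (rule inj_onI)
  fix u v
  assume uv: "u \<in> {..<a} \<times> {a..<a+b}" "v \<in> {..<a} \<times> {a..<a+b}"
    "(case u of (i, j) \<Rightarrow> i * b + (j - a) + 2) = (case v of (i, j) \<Rightarrow> i * b + (j - a) + 2)"
  obtain i j i' j' where ij: "u = (i, j)" "v = (i', j')" by (cases u, cases v)
  have *: "a \<le> j" "a \<le> j'" "j - a < b" "j' - a < b" "i * b + (j - a) = i' * b + (j' - a)"
    using uv by (auto simp: ij)
  have "(i * b + t) div b = i" if "t < b" for i t using that by auto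
  then have "i = i'" using *(3-5) by metis
  then show "u = v" using * by (simp add: ij)
qed

text \<open>The base-b expansions run through 0, ..., a b - 1, and the offset 2 places them just
  after colour 1.\<close>

lemma surj_bip_colouring: "surj_colouring (a * b + 1) (bip_colouring a b)"
  unfolding surj_colouring_def bip_colouring_image[OF infinite_UNIV_nat] Int_UNIV_left
proof (intro equalityI subsetI)
  fix c assume "c \<in> insert 1 ((\<lambda>(i, j). i * b + (j - a) + 2) ` ({..<a} \<times> {a..<a+b}))"
  then consider "c = 1" | u where "u \<in> {..<a} \<times> {a..<a+b}" "c = fst u * b + (snd u - a) + 2"
    by (auto simp: case_prod_unfold)
  then show "c \<in> {1..a * b + 1}"
  proof cases
    case 2
    have "fst u * b + (snd u - a) < Suc (fst u) * b" using 2 by auto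
    also have "\<dots> \<le> a * b" using 2 by (intro mult_le_mono) auto
    finally show ?thesis using 2 by simp
  qed auto
next
  fix c assume c: "c \<in> {1..a * b + 1}"
  show "c \<in> insert 1 ((\<lambda>(i, j). i * b + (j - a) + 2) ` ({..<a} \<times> {a..<a+b}))"
  proof (cases "c = 1")
    case False
    then have lt: "c - 2 < a * b" using c by auto
    then have b: "b > 0" by (cases b) auto
    define q r where "q = (c - 2) div b" and "r = (c - 2) mod b"
    have "q < a" using lt by (simp add: q_def less_mult_imp_div_less)
    moreover have "r < b" using b by (simp add: r_def)
    moreover have "c - 2 = q * b + r" by (simp add: q_def r_def)
    then have "c = q * b + r + 2" using False c by auto
    ultimately show ?thesis
      by (intro insertI2 image_eqI[of _ _ "(q, a + r)"]) auto
  qed simp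
qed

text \<open>A set meeting the two parts in u and v elements sees u v + 1 colours. The product u v is
  a table entry or 0, and the value 0 accounts for the final 1.\<close>

lemma psi_mult_le: "psi (a * b + 1) \<le> card ((\<lambda>(x, y). x * y) ` ({1..a} \<times> {1..b})) + 1"
proof -
  define M where "M = (\<lambda>(x, y). x * y) ` ({1..a} \<times> {1..b})"
  have "color_counts (a * b + 1) (bip_colouring a b) \<subseteq> Suc ` insert 0 M"
  proof
    fix m assume "m \<in> color_counts (a * b + 1) (bip_colouring a b)"
    then obtain X where X: "infinite X" "m = card (bip_colouring a b ` nsets X 2)"
      by (auto simp: color_counts_def exactly_coloured_def)
    define U V where "U = X \<inter> {..<a}" and "V = X \<inter> {a..<a+b}"
    have fin: "finite U" "finite V" by (auto simp: U_def V_def)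
    have "m = Suc (card ((\<lambda>(i, j). i * b + (j - a) + 2) ` (U \<times> V)))"
      unfolding X(2) bip_colouring_image[OF X(1)] U_def[symmetric] V_def[symmetric]
      using fin by (subst card_insert_disjoint) auto
    also have "inj_on (\<lambda>(i, j). i * b + (j - a) + 2) (U \<times> V)"
      by (rule inj_on_subset[OF inj_on_bip]) (auto simp: U_def V_def)
    then have "card ((\<lambda>(i, j). i * b + (j - a) + 2) ` (U \<times> V)) = card U * card V"
      by (simp only: card_image card_cartesian_product)
    finally have m: "m = Suc (card U * card V)" .
    have "card U \<le> a" "card V \<le> b"
      using card_mono[of "{..<a}" U] card_mono[of "{a..<a+b}" V] by (auto simp: U_def V_def)
    then have "card U * card V \<in> insert 0 M"
      by (cases "card U = 0 \<or> card V = 0") (auto simp: M_def Suc_le_eq intro!: image_eqI[of _ _ "(card U, card V)"])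
    then show "m \<in> Suc ` insert 0 M" using m by blast
  qed
  moreover have "finite M" by (simp add: M_def)
  ultimately have "card (color_counts (a * b + 1) (bip_colouring a b)) \<le> card (insert 0 M)"
    by (intro surj_card_le) auto
  also have "\<dots> \<le> card M + 1" using \<open>finite M\<close> by (simp add: card_insert_if)
  finally show ?thesis using psi_le[OF surj_bip_colouring, of a b] by (simp add: M_def)
qed

section \<open>Integers with a balanced factorisation\<close>

lemma ln_ln_2_ge: "ln (ln 2) \<ge> - (1 / 2 :: real)"
proof -
  have "ln (2 / 3 :: real) \<le> ln (ln 2)"
    using ln2_ge_two_thirds by (subst ln_le_cancel_iff) auto
  moreover have "ln (3 / 2 :: real) \<le> 1 / 2" using ln_le_minus_one[of "3 / 2"] by simp
  moreover have "ln (2 / 3 :: real) = - ln (3 / 2)" by (simp add: ln_div)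
  ultimately show ?thesis by linarith
qed

lemma ln_2_le_1: "ln 2 \<le> (1 :: real)"
  using ln_le_minus_one[of 2] by simp

text \<open>Equivalent to 1 + ln (ln 2) >= (ln 2)/2. The distance from 1 leaves room for the triple
  logarithm in \<open>powr_ford_delta_le\<close>.\<close>

lemma ford_delta_le: "ford_delta \<le> 1 / 2"
proof -
  have "(1 / 2) * ln 2 \<le> 1 + ln (ln (2 :: real))" using ln_ln_2_ge ln_2_le_1 by linarith
  then have "1 / 2 \<le> (1 + ln (ln (2 :: real))) / ln 2" by (simp add: le_divide_eq)
  then show ?thesis by (simp add: ford_delta_def)
qed

lemma recip_sum_primes_ge': "recip_sum (primes_upto (2 ^ 2 ^ t)) \<ge> 2 / 3 * real t - 3 / 2"
proof -
  have "real t * (2 / 3) \<le> real t * ln 2" using ln2_ge_two_thirds by (intro mult_left_mono) auto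
  then show ?thesis using recip_sum_primes_ge[of t] ln_ln_2_ge ln_2_le_1 by linarith
qed

text \<open>Natural logarithms are later paired with powers of 2: since ln 2 < 1, 2^(2^(loglog k))
  lies below any fixed positive power of k for large k. Negative values become 0 under
  \<open>nat\<close>.\<close>

definition loglog :: "nat \<Rightarrow> nat" where
  "loglog k = nat \<lfloor>ln (ln (real k))\<rfloor>"

lemma loglog_mono:
  assumes "2 \<le> k" "k \<le> n"
  shows "loglog k \<le> loglog n"
proof -
  have "ln (real k) > 0" using assms by simp
  moreover have "ln (real k) \<le> ln (real n)" using assms by simp
  ultimately have "ln (ln (real k)) \<le> ln (ln (real n))" by simp
  then show ?thesis unfolding loglog_def by (intro nat_mono floor_mono)
qed

lemma loglog_ge: "real (loglog k) \<ge> ln (ln (real k)) - 1"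
  unfolding loglog_def by linarith

lemma loglog_le: "ln (ln (real k)) \<ge> 0 \<Longrightarrow> real (loglog k) \<le> ln (ln (real k))"
  unfolding loglog_def by simp

text \<open>
  The sum of \<open>1 / p\<close> over the primes up to \<open>2 ^ 2 ^ s\<close> lies between \<open>2 s / 3\<close> and \<open>2 s\<close>, up to bounded
  errors. Dividing by 10 leaves a divergent sum over the primes between \<open>2 ^ 2 ^ (t div 10)\<close> and
  \<open>2 ^ 2 ^ t\<close>.
\<close>

definition balanced_succ :: "nat \<Rightarrow> nat set" where
  "balanced_succ K = {k. k \<ge> K \<and>
     (\<exists>a b. k = a * b + 1 \<and> 2 ^ 2 ^ (loglog k div 10) \<le> a \<and> 2 ^ 2 ^ (loglog k div 10) \<le> b)}"

text \<open>The table bound has constant 404, and the extra 1 in \<open>psi_mult_le\<close> is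
  absorbed because L <= \<open>card (primes_upto z)\<close> <= a <= a b, which gives 405.\<close>

lemma psi_le_of_factors:
  assumes "z \<le> a" "z \<le> b" and L: "recip_sum (primes_upto z) > 0"
  shows "real (psi (a * b + 1)) \<le> 405 * real (a * b + 1) / recip_sum (primes_upto z)"
proof -
  define L where "L = recip_sum (primes_upto z)"
  have prime: "prime p" if "p \<in> primes_upto z" for p using that by (simp add: primes_upto_def)
  have card: "card (primes_upto z) \<le> a" "card (primes_upto z) \<le> b"
    using assms(1,2) card_primes_upto_le[of z] by auto
  have "real (card (primes_upto z)) > 0"
    using L recip_sum_le_card[OF prime] by (rule order_less_le_trans)
  then have b: "b \<ge> 1" using card by linarith
  have "L \<le> real (card (primes_upto z))" unfolding L_def by (rule recip_sum_le_card[OF prime])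
  also have "\<dots> \<le> real a" using card by simp
  also have "\<dots> \<le> real (a * b)" using b by (simp add: mult_ge1_I mult_le_cancel_left1 del: of_nat_mult)
  finally have "1 \<le> real (a * b) / L" using L by (simp add: L_def)
  moreover have "real (psi (a * b + 1)) \<le> real (card ((\<lambda>(x, y). x * y) ` ({1..a} \<times> {1..b})) + 1)"
    using psi_mult_le by (simp only: of_nat_le_iff)
  moreover have "real (card ((\<lambda>(x, y). x * y) ` ({1..a} \<times> {1..b}))) \<le> 404 * (real a * real b) / L"
    unfolding L_def using card_mult_table_le[OF finite_primes_upto prime card L] .
  ultimately have "real (psi (a * b + 1)) \<le> 405 * real (a * b) / L" by simp
  also have "\<dots> \<le> 405 * real (a * b + 1) / L"
    using L by (intro divide_right_mono) (auto simp: L_def)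
  finally show ?thesis by (simp add: L_def)
qed

lemma psi_le_balanced_succ:
  assumes k: "k \<in> balanced_succ K" and x: "ln (ln (real k)) \<ge> 70"
  shows "real (psi k) \<le> 12150 * real k / ln (ln (real k))"
proof -
  define s where "s = loglog k div 10"
  define L where "L = recip_sum (primes_upto (2 ^ 2 ^ s))"
  obtain a b where ab: "k = a * b + 1" "2 ^ 2 ^ s \<le> a" "2 ^ 2 ^ s \<le> b"
    using k by (auto simp: balanced_succ_def s_def)
  have "loglog k \<le> 10 * s + 9" unfolding s_def by presburger
  then have "real (loglog k) \<le> 10 * real s + 9" by linarith
  \<comment> \<open>With x = ln (ln k), s >= (x - 10)/10 and so L >= x/15 - 13/6, which is at least
    x/30 once x >= 65.\<close>
  then have L: "L \<ge> ln (ln (real k)) / 30"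
    using recip_sum_primes_ge'[of s] loglog_ge[of k] x unfolding L_def by linarith
  then have L0: "L > 0" using x by linarith
  have "real (psi k) \<le> 405 * real k / L"
    unfolding ab(1) L_def by (rule psi_le_of_factors) (use ab L0 in \<open>auto simp: L_def\<close>)
  also have "\<dots> \<le> 405 * real k / (ln (ln (real k)) / 30)"
    using L L0 x by (intro divide_left_mono mult_pos_pos) auto
  finally show ?thesis by simp
qed

text \<open>From ln u <= u at u = x^(1/4) follows (ln x)^(3/2) <= 8 x^(3/8), and the total exponent
  1/2 + 3/8 = 7/8 stays below 1.\<close>

lemma powr_ford_delta_le:
  fixes x :: real
  assumes x: "x \<ge> 1"
  shows "x powr ford_delta * ln x powr (3 / 2) \<le> 8 * x"
proof -
  have "ln x / 4 = ln (x powr (1 / 4))" using x by (simp add: ln_powr)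
  also have "\<dots> \<le> x powr (1 / 4)" using x ln_le_minus_one[of "x powr (1 / 4)"] by simp
  finally have "ln x \<le> 4 * x powr (1 / 4)" by simp
  then have "ln x powr (3 / 2) \<le> (4 * x powr (1 / 4)) powr (3 / 2)"
    using x by (intro powr_mono2) auto
  also have "\<dots> = 4 powr (3 / 2) * x powr (3 / 8)" using x by (simp add: powr_mult powr_powr)
  also have "(4 :: real) powr (3 / 2) = (2 powr 2) powr (3 / 2)" by simp
  also have "\<dots> = 8" unfolding powr_powr by simp
  finally have ln: "ln x powr (3 / 2) \<le> 8 * x powr (3 / 8)" .
  have "x powr ford_delta * ln x powr (3 / 2) \<le> x powr (1 / 2) * (8 * x powr (3 / 8))"
    using x ford_delta_le by (intro mult_mono ln powr_mono) auto
  also have "\<dots> = 8 * x powr (7 / 8)" by (simp flip: powr_add)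
  also have "\<dots> \<le> 8 * x powr 1" using x by (intro mult_left_mono powr_mono) auto
  finally show ?thesis using x by simp
qed

text \<open>An excluded k is below \<open>K\<close>, or at most z^2, or k - 1 has no prime divisor
  in (w, z]. In the last case the divisor count 0 misses its mean by the whole mean, which Turan's
  inequality with c = 1 makes rare.\<close>

lemma card_compl_balanced_succ_le:
  assumes z: "(2 ^ 2 ^ loglog n) ^ 4 \<le> n" and t: "real (loglog n) \<ge> 10" and K: "K \<ge> 2"
  shows "real (card ({1..n} - balanced_succ K))
           \<le> real K + real n / real (loglog n) + 3 * real n / (real (loglog n) / 3 - 5 / 2) + 1"
proof -
  define t s where "t = loglog n" and "s = t div 10"
  define z w :: nat where "z = 2 ^ 2 ^ t" and "w = 2 ^ 2 ^ s"
  define Q where "Q = primes_upto z - primes_upto w"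
  define B where "B = {m\<in>{1..n}. \<bar>real (num_div Q m) - recip_sum Q\<bar> \<ge> 1 * recip_sum Q}"
  have wz: "w \<le> z" by (simp add: w_def z_def s_def)
  have z1: "z \<ge> 1" by (simp add: z_def)
  have finQ: "finite Q" by (simp add: Q_def)
  have prime: "prime p" if "p \<in> Q" for p using that by (simp add: Q_def primes_upto_def)
  have "recip_sum Q = recip_sum (primes_upto z) - recip_sum (primes_upto w)"
    unfolding recip_sum_def Q_def using wz by (intro sum_diff) (auto simp: primes_upto_def)
  moreover have "10 * real s \<le> real t" unfolding s_def by linarith
  \<comment> \<open>The difference 2t/3 - 3/2 - (1 + 2s) with s <= t/10 is at least 7t/15 -
    5/2.\<close>
  ultimately have LQ: "recip_sum Q \<ge> real t / 3 - 5 / 2"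
    using recip_sum_primes_ge'[of t] recip_sum_primes_le[of s] unfolding z_def w_def by linarith
  have pos: "real t / 3 - 5 / 2 > 0" using t by (simp add: t_def)
  have "card Q \<le> z"
    using card_mono[of "primes_upto z" Q] card_primes_upto_le[of z] by (auto simp: Q_def)
  also have "z \<le> z ^ 4" using z1 by (simp add: self_le_power)
  also have z4: "z ^ 4 \<le> n" using z by (simp add: z_def t_def)
  finally have cardQ: "card Q \<le> n" .
  have "{1..n} - balanced_succ K \<subseteq> {..<K} \<union> {..z ^ 2} \<union> Suc ` B"
  proof
    fix k assume k: "k \<in> {1..n} - balanced_succ K"
    show "k \<in> {..<K} \<union> {..z ^ 2} \<union> Suc ` B"
    proof (rule ccontr)
      assume "\<not> ?thesis"
      then have k': "k \<ge> K" "k > z ^ 2" "k \<notin> Suc ` B" by auto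
      define m where "m = k - 1"
      have m: "k = Suc m" "m \<in> {1..n}" "m \<ge> z ^ 2" using k k' K by (auto simp: m_def)
      then have "m \<notin> B" using k' by auto
      then have "num_div Q m \<noteq> 0" using m LQ pos by (auto simp: B_def)
      then obtain p where p: "p \<in> Q" "p dvd m"
        unfolding num_div_def by (metis (mono_tags, lifting) card.empty empty_Collect_eq)
      then obtain b where b: "m = p * b" by auto
      have pz: "p \<le> z" "p > w" using p by (auto simp: Q_def primes_upto_def)
      \<comment> \<open>Since p <= z and m >= z^2, the cofactor of p is at least z.\<close>
      have "z * z \<le> z * b" using m(3) pz(1) unfolding b
        by (metis (no_types) mult_le_mono1 order_trans power2_eq_square)
      then have "z \<le> b" using z1 by simp
      \<comment> \<open>Monotonicity replaces the threshold depending on k by the single threshold w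
        for all k <= n.\<close>
      have "loglog k div 10 \<le> s"
        unfolding s_def t_def using k k' K by (intro div_le_mono loglog_mono) auto
      then have "(2::nat) ^ 2 ^ (loglog k div 10) \<le> w" unfolding w_def by simp
      then have "k \<in> balanced_succ K"
        using k'(1) m(1) b pz \<open>z \<le> b\<close> wz unfolding balanced_succ_def
        by (intro CollectI conjI exI[of _ p] exI[of _ b]) auto
      then show False using k by simp
    qed
  qed
  then have "card ({1..n} - balanced_succ K) \<le> card ({..<K} \<union> {..z ^ 2} \<union> Suc ` B)"
    by (intro card_mono) (auto simp: B_def)
  also have "\<dots> \<le> card {..<K} + card {..z ^ 2} + card (Suc ` B)"
    by (intro order_trans[OF card_Un_le] add_mono order_refl)
  also have "\<dots> = K + (z ^ 2 + 1) + card B" by (simp add: card_image)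
  finally have "real (card ({1..n} - balanced_succ K)) \<le> real (K + (z ^ 2 + 1) + card B)"
    by (simp only: of_nat_le_iff)
  then have "real (card ({1..n} - balanced_succ K)) \<le> real K + (real z ^ 2 + 1) + real (card B)"
    by simp
  also have "real z ^ 2 \<le> real n / real t"
  proof -
    have "t < 2 ^ t" "(2::nat) ^ t < 2 ^ 2 ^ t" by (rule less_exp)+
    then have "t \<le> z" unfolding z_def by linarith
    also have "z \<le> z ^ 2" using z1 by (simp add: self_le_power)
    finally have "z ^ 2 * t \<le> z ^ 2 * z ^ 2" by (rule mult_le_mono2)
    also have "\<dots> = z ^ 4" by (simp add: power4_eq_xxxx power2_eq_square)
    also have "\<dots> \<le> n" by (rule z4)
    finally have "real (z ^ 2 * t) \<le> real n" by (simp only: of_nat_le_iff)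
    then show ?thesis using t by (simp add: le_divide_eq t_def)
  qed
  also have "real (card B) \<le> 3 * real n / recip_sum Q"
    using turan_card[OF finQ prime cardQ, of 1] LQ pos by (simp add: B_def)
  also have "\<dots> \<le> 3 * real n / (real t / 3 - 5 / 2)"
    using LQ pos by (intro divide_left_mono) auto
  finally show ?thesis by (simp add: t_def)
qed

text \<open>As ln 2 <= 25/36 < 7/10, eventually 2^(loglog n) <= (ln n)^(7/10), and four times this
  is eventually at most ln n.\<close>

lemma eventually_pow_loglog_le: "eventually (\<lambda>n. (2 ^ 2 ^ loglog n) ^ 4 \<le> n) sequentially"
proof -
  have "eventually (\<lambda>n. 4 * exp (7 / 10 * ln (ln (real n))) \<le> ln (real n)) sequentially"
    "eventually (\<lambda>n. ln (ln (real n)) \<ge> 0) sequentially" "eventually (\<lambda>n. n > 0) sequentially"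
    by real_asymp+
  then show ?thesis
  proof eventually_elim
    case (elim n)
    have "real (loglog n) * ln 2 \<le> ln (ln (real n)) * (7 / 10)"
      using loglog_le[OF elim(2)] elim(2) ln2_le_25_over_36 by (intro mult_mono) auto
    then have "exp (real (loglog n) * ln 2) \<le> exp (7 / 10 * ln (ln (real n)))" by simp
    moreover have "exp (real (loglog n) * ln 2) = 2 ^ loglog n" by (simp add: exp_of_nat_mult)
    ultimately have le: "4 * 2 ^ loglog n \<le> ln (real n)" using elim(1) by linarith
    define Z :: nat where "Z = (2 ^ 2 ^ loglog n) ^ 4"
    have "Z > 0" by (simp add: Z_def)
    have "ln (real Z) = (4 * 2 ^ loglog n) * ln 2"
      by (simp add: Z_def ln_realpow)
    also have "\<dots> \<le> (4 * 2 ^ loglog n) * 1" using ln_2_le_1 by (intro mult_left_mono) auto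
    also have "\<dots> \<le> ln (real n)" using le by simp
    finally have "Z \<le> n" using elim(3) \<open>Z > 0\<close> by simp
    then show ?case unfolding Z_def .
  qed
qed

lemma has_density_balanced_succ:
  assumes K: "K \<ge> 2"
  shows "has_density (balanced_succ K) 1"
proof -
  \<comment> \<open>The relative size of the complement, with \<open>loglog n\<close> replaced by
    its lower bound ln (ln n) - 1.\<close>
  define f where "f = (\<lambda>n. (real K + 1) / real n + 1 / (ln (ln (real n)) - 1)
    + 3 / ((ln (ln (real n)) - 1) / 3 - 5 / 2))"
  have f: "f \<longlonglongrightarrow> 0" unfolding f_def by real_asymp
  have "eventually (\<lambda>n. ln (ln (real n)) \<ge> 20) sequentially" "eventually (\<lambda>n. n > 0) sequentially"
    by real_asymp+
  with eventually_pow_loglog_le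
  have lower: "eventually (\<lambda>n. 1 - f n \<le> real (card (balanced_succ K \<inter> {1..n})) / real n) sequentially"
  proof eventually_elim
    case (elim n)
    define t where "t = real (loglog n)"
    have t: "t \<ge> ln (ln (real n)) - 1" unfolding t_def by (rule loglog_ge)
    have cancel: "real n * ((real K + 1) / real n) = real K + 1" using elim by simp
    have "real (card ({1..n} - balanced_succ K)) \<le> real K + real n / t + 3 * real n / (t / 3 - 5 / 2) + 1"
      unfolding t_def using elim t K by (intro card_compl_balanced_succ_le) (auto simp: t_def)
    also have "\<dots> = real n * ((real K + 1) / real n + 1 / t + 3 / (t / 3 - 5 / 2))"
      unfolding distrib_left cancel by simp
    also have "\<dots> \<le> real n * f n"
      unfolding f_def using elim t by (intro mult_left_mono add_mono divide_left_mono) auto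
    finally have "real (card ({1..n} - balanced_succ K)) \<le> real n * f n" .
    moreover have "card (balanced_succ K \<inter> {1..n}) + card ({1..n} - balanced_succ K) = n"
      using card_Int_Diff[of "{1..n}" "balanced_succ K"] by (simp add: Int_commute)
    then have "real (card (balanced_succ K \<inter> {1..n})) = real n - real (card ({1..n} - balanced_succ K))"
      by linarith
    ultimately show ?case using elim by (simp add: le_divide_eq right_diff_distrib mult.commute)
  qed
  have upper: "eventually (\<lambda>n. real (card (balanced_succ K \<inter> {1..n})) / real n \<le> 1) sequentially"
  proof (intro always_eventually allI)
    fix n show "real (card (balanced_succ K \<inter> {1..n})) / real n \<le> 1"
      using card_mono[of "{1..n}" "balanced_succ K \<inter> {1..n}"] by (simp add: divide_le_eq)
  qed
  show ?thesis
    unfolding has_density_def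
    by (rule tendsto_sandwich[OF lower upper]) (use tendsto_diff[OF tendsto_const f, of 1] in simp_all)
qed

theorem theorem2:
  shows "\<exists>A :: nat set. has_density A 1 \<and>
    (\<exists>C :: real. C > 0 \<and> (\<forall>k\<in>A. k \<ge> 16 \<longrightarrow>
      real (psi k) \<le> C * (real k /
        (ln (ln (real k)) powr ford_delta * ln (ln (ln (real k))) powr (3 / 2)))))"
proof -
  \<comment> \<open>Starting the set at such a \<open>K\<close> puts all its elements past the
    threshold of \<open>psi_le_balanced_succ\<close>.\<close>
  have "eventually (\<lambda>k. ln (ln (real k)) \<ge> 70) sequentially" by real_asymp
  then obtain K where K: "\<And>k. k \<ge> K \<Longrightarrow> ln (ln (real k)) \<ge> 70"
    unfolding eventually_sequentially by blast
  \<comment> \<open>97200 = 8 * 12150, the factor 8 coming from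
    \<open>powr_ford_delta_le\<close>.\<close>
  have "real (psi k) \<le> 97200 * (real k /
      (ln (ln (real k)) powr ford_delta * ln (ln (ln (real k))) powr (3 / 2)))"
    if k: "k \<in> balanced_succ (max 2 K)" for k
  proof -
    define x where "x = ln (ln (real k))"
    have "k \<ge> K" using k by (auto simp: balanced_succ_def)
    then have x: "x \<ge> 70" using K by (simp add: x_def)
    define D where "D = x powr ford_delta * ln x powr (3 / 2)"
    have D: "D > 0" "D \<le> 8 * x" using x powr_ford_delta_le[of x] by (auto simp: D_def)
    have "real (psi k) \<le> 12150 * real k / x"
      using psi_le_balanced_succ[OF k] x by (simp add: x_def)
    also have "\<dots> = 97200 * real k / (8 * x)" using x by simp
    also have "\<dots> \<le> 97200 * real k / D"
      using D x by (intro divide_left_mono) auto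
    finally show ?thesis by (simp add: D_def x_def)
  qed
  moreover have "has_density (balanced_succ (max 2 K)) 1" by (rule has_density_balanced_succ) simp
  ultimately show ?thesis by (intro exI[of _ "balanced_succ (max 2 K)"] conjI exI[of _ 97200]) auto
qed

end
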